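(* Let $\ast_c$ be a choice revision on $K$. Then $\ast_c$ satisfies $\ast_c$-closure, $\ast_c$-relative success, $\ast_c$-regularity, $\ast_c$-confirmation and $\ast_c$-reciprocity iff there is a multi-believability relation $\preceq_{c}$ satisfying $\preceq_{c}$-transitivity, $\preceq_{c}$-weak coupling, $\preceq_{c}$-counter dominance, $\preceq_{c}$-minimality and $\preceq_{c}$-union such that for every finite $A$: $K \ast_c A = \{\varphi \mid A \simeq_{c} \{\psi\wedge\varphi \mid \psi\in A\}\}$ if $A \prec_{c} \emptyset$, and $K \ast_c A = K$ otherwise.
   Context: $\mathcal{L}$ is a propositional language (not necessarily finite) with consequence operation $\mathrm{Cn}$ (supraclassical, compact, deduction property); $X\vdash\varphi$ means $\varphi\in\mathrm{Cn}(X)$. $K$ is a fixed consistent belief set ($K=\mathrm{Cn}(K)$). A choice revision $\ast_c$ on $K$ maps each finite $A\subseteq\mathcal{L}$ to a set $K\ast_c A$. Postulates (for finite $A,B$): closure: $\mathrm{Cn}(K\ast_c A)=K\ast_c A$; relative success: $K\ast_c A=K$ or $A\cap(K\ast_c A)\neq\emptyset$; regularity: if $A\cap(K\ast_c B)\neq\emptyset$ then $A\cap(K\ast_c A)\neq\emptyset$; confirmation: if $A\cap K\neq\emptyset$ then $K\ast_c A=K$; reciprocity: if $(K\ast_c A)\cap B\neq\emptyset$ and $(K\ast_c B)\cap A\neq\emptyset$ then $K\ast_c A=K\ast_c B$. A multi-believability relation $\preceq_{c}$ is a binary relation on finite subsets of $\mathcal{L}$ (symmetric part $\simeq_{c}$,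 strict part $\prec_{c}$; $\{\varphi\}$ written $\varphi$). Postulates (for finite $A,B,C$): transitivity: if $A\preceq_{c}B$ and $B\preceq_{c}C$ then $A\preceq_{c}C$; weak coupling: if $A\simeq_{c}\{\varphi\wedge\psi\mid\varphi\in A,\psi\in B\}$ and $A\simeq_{c}\{\varphi\wedge\chi\mid\varphi\in A,\chi\in C\}$ then $A\simeq_{c}\{(\varphi\wedge\psi)\wedge\chi\mid\varphi\in A,\psi\in B,\chi\in C\}$; counter dominance: if for every $\varphi\in B$ there is $\psi\in A$ with $\varphi\vdash\psi$ then $A\preceq_{c}B$; minimality: $A\preceq_{c}B$ for all $B$ iff $A\cap K\neq\emptyset$; union: $A\preceq_{c}A\cup B$ or $B\preceq_{c}A\cup B$. *)

theory Defs
  imports Main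
begin

datatype 'v fm =
    Atom 'v
  | Neg "'v fm"
  | Con "'v fm" "'v fm"  (infixr "\<^bold>\<and>" 135)
  | Dis "'v fm" "'v fm"  (infixr "\<^bold>\<or>" 130)
  | Imp "'v fm" "'v fm"  (infixr "\<^bold>\<rightarrow>" 125)

primrec holds :: "('v \<Rightarrow> bool) \<Rightarrow> 'v fm \<Rightarrow> bool" where
  "holds v (Atom p) = v p"
| "holds v (Neg \<phi>) = (\<not> holds v \<phi>)"
| "holds v (\<phi> \<^bold>\<and> \<psi>) = (holds v \<phi> \<and> holds v \<psi>)"
| "holds v (\<phi> \<^bold>\<or> \<psi>) = (holds v \<phi> \<or> holds v \<psi>)"
| "holds v (\<phi> \<^bold>\<rightarrow> \<psi>) = (holds v \<phi> \<longrightarrow> holds v \<psi>)"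

definition taut_conseq :: "'v fm set \<Rightarrow> 'v fm \<Rightarrow> bool" where
  "taut_conseq X \<phi> \<longleftrightarrow> (\<forall>v. (\<forall>\<psi>\<in>X. holds v \<psi>) \<longrightarrow> holds v \<phi>)"

text \<open>The first three assumptions are Tarski's conditions on a consequence operation.\<close>

locale consequence_operation =
  fixes Cn :: "'v fm set \<Rightarrow> 'v fm set"
  assumes inclusion: "X \<subseteq> Cn X"
    and monotony: "X \<subseteq> Y \<Longrightarrow> Cn X \<subseteq> Cn Y"
    and iteration: "Cn (Cn X) = Cn X"
    and supraclassicality: "taut_conseq X \<phi> \<Longrightarrow> \<phi> \<in> Cn X"
    and compactness: "\<phi> \<in> Cn X \<Longrightarrow> \<exists>Y. finite Y \<and> Y \<subseteq> X \<and> \<phi> \<in> Cn Y"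
    and deduction: "\<psi> \<in> Cn (X \<union> {\<phi>}) \<longleftrightarrow> (\<phi> \<^bold>\<rightarrow> \<psi>) \<in> Cn X"

locale consistent_belief_set = consequence_operation Cn
  for Cn :: "'v fm set \<Rightarrow> 'v fm set" +
  fixes K :: "'v fm set"
  assumes belief_set: "K = Cn K"
    and consistent: "\<not> (\<exists>\<phi>. \<phi> \<in> Cn K \<and> Neg \<phi> \<in> Cn K)"

text \<open>
  A choice revision on \<open>K\<close> is a function \<open>cr\<close>, with \<open>cr A\<close> standing for the result of
  revising \<open>K\<close> by \<open>A\<close>. Only finite inputs are meaningful, so the values of \<open>cr\<close> on
  infinite sets are never mentioned; similarly for relations \<open>R\<close> between finite sets below.
\<close>

definition rev_closure :: "('v fm set \<Rightarrow> 'v fm set) \<Rightarrow> ('v fm set \<Rightarrow> 'v fm set) \<Rightarrow> bool" where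
  "rev_closure Cn cr \<longleftrightarrow> (\<forall>A. finite A \<longrightarrow> Cn (cr A) = cr A)"

definition rev_relative_success :: "'v fm set \<Rightarrow> ('v fm set \<Rightarrow> 'v fm set) \<Rightarrow> bool" where
  "rev_relative_success K cr \<longleftrightarrow> (\<forall>A. finite A \<longrightarrow> cr A = K \<or> A \<inter> cr A \<noteq> {})"

definition rev_regularity :: "('v fm set \<Rightarrow> 'v fm set) \<Rightarrow> bool" where
  "rev_regularity cr \<longleftrightarrow>
    (\<forall>A B. finite A \<longrightarrow> finite B \<longrightarrow> A \<inter> cr B \<noteq> {} \<longrightarrow> A \<inter> cr A \<noteq> {})"

definition rev_confirmation :: "'v fm set \<Rightarrow> ('v fm set \<Rightarrow> 'v fm set) \<Rightarrow> bool" where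
  "rev_confirmation K cr \<longleftrightarrow> (\<forall>A. finite A \<longrightarrow> A \<inter> K \<noteq> {} \<longrightarrow> cr A = K)"

definition rev_reciprocity :: "('v fm set \<Rightarrow> 'v fm set) \<Rightarrow> bool" where
  "rev_reciprocity cr \<longleftrightarrow>
    (\<forall>A B. finite A \<longrightarrow> finite B \<longrightarrow>
      cr A \<inter> B \<noteq> {} \<longrightarrow> cr B \<inter> A \<noteq> {} \<longrightarrow> cr A = cr B)"

type_synonym 'v set_rel = "'v fm set \<Rightarrow> 'v fm set \<Rightarrow> bool"

definition sym_part :: "'v set_rel \<Rightarrow> 'v set_rel" where
  "sym_part R A B \<longleftrightarrow> R A B \<and> R B A"

definition strict_part :: "'v set_rel \<Rightarrow> 'v set_rel" where
  "strict_part R A B \<longleftrightarrow> R A B \<and> \<not> R B A"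

definition bel_transitivity :: "'v set_rel \<Rightarrow> bool" where
  "bel_transitivity R \<longleftrightarrow>
    (\<forall>A B C. finite A \<longrightarrow> finite B \<longrightarrow> finite C \<longrightarrow> R A B \<longrightarrow> R B C \<longrightarrow> R A C)"

definition bel_weak_coupling :: "'v set_rel \<Rightarrow> bool" where
  "bel_weak_coupling R \<longleftrightarrow>
    (\<forall>A B C. finite A \<longrightarrow> finite B \<longrightarrow> finite C \<longrightarrow>
      sym_part R A {\<phi> \<^bold>\<and> \<psi> | \<phi> \<psi>. \<phi> \<in> A \<and> \<psi> \<in> B} \<longrightarrow>
      sym_part R A {\<phi> \<^bold>\<and> \<chi> | \<phi> \<chi>. \<phi> \<in> A \<and> \<chi> \<in> C} \<longrightarrow>
      sym_part R A {(\<phi> \<^bold>\<and> \<psi>) \<^bold>\<and> \<chi> | \<phi> \<psi> \<chi>. \<phi> \<in> A \<and> \<psi> \<in> B \<and> \<chi> \<in> C})"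

definition bel_counter_dominance :: "('v fm set \<Rightarrow> 'v fm set) \<Rightarrow> 'v set_rel \<Rightarrow> bool" where
  "bel_counter_dominance Cn R \<longleftrightarrow>
    (\<forall>A B. finite A \<longrightarrow> finite B \<longrightarrow> (\<forall>\<phi>\<in>B. \<exists>\<psi>\<in>A. \<psi> \<in> Cn {\<phi>}) \<longrightarrow> R A B)"

definition bel_minimality :: "'v fm set \<Rightarrow> 'v set_rel \<Rightarrow> bool" where
  "bel_minimality K R \<longleftrightarrow>
    (\<forall>A. finite A \<longrightarrow> ((\<forall>B. finite B \<longrightarrow> R A B) \<longleftrightarrow> A \<inter> K \<noteq> {}))"

definition bel_union :: "'v set_rel \<Rightarrow> bool" where
  "bel_union R \<longleftrightarrow>
    (\<forall>A B. finite A \<longrightarrow> finite B \<longrightarrow> R A (A \<union> B) \<or> R B (A \<union> B))"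

end

theory Submission imports Defs begin

text \<open>
  Read \<open>cr A\<close> as the choice of an outcome among those meeting \<open>A\<close>. The outcomes
  meeting \<open>A \<union> B\<close> are exactly those meeting \<open>A\<close> or \<open>B\<close>, so menus are closed under finite
  unions and the revealed preference \<open>A \<inter> cr (A \<union> B) \<noteq> {}\<close> is already transitive, by reciprocity
  applied to \<open>A \<union> B \<union> C\<close>. Sets that no outcome meets are put level with the empty set,
  as the least believable ones.
  Conversely, the union postulate singles out from each \<open>A \<prec> {}\<close> an
  element equivalent to \<open>A\<close>, which yields success, and weak coupling makes
  the set of \<open>\<phi>\<close> with \<open>A \<simeq> {\<psi> \<and> \<phi> | \<psi> \<in> A}\<close> closed under conjunction.
\<close>

section \<open>Elementwise conjunctions and deductively closed sets\<close>

definition con_set :: "'v fm set \<Rightarrow> 'v fm set \<Rightarrow> 'v fm set" where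
  "con_set A B = {\<phi> \<^bold>\<and> \<psi> | \<phi> \<psi>. \<phi> \<in> A \<and> \<psi> \<in> B}"

lemma con_set_image: "con_set A B = (\<lambda>(\<phi>, \<psi>). \<phi> \<^bold>\<and> \<psi>) ` (A \<times> B)"
  by (auto simp: con_set_def)

lemma finite_con_set [simp]: "finite A \<Longrightarrow> finite B \<Longrightarrow> finite (con_set A B)"
  by (simp add: con_set_image)

lemma ball_con_set [simp]: "(\<forall>\<phi>\<in>con_set A B. P \<phi>) \<longleftrightarrow> (\<forall>\<phi>\<in>A. \<forall>\<psi>\<in>B. P (\<phi> \<^bold>\<and> \<psi>))"
  by (auto simp: con_set_def)

lemma bex_con_set [simp]: "(\<exists>\<phi>\<in>con_set A B. P \<phi>) \<longleftrightarrow> (\<exists>\<phi>\<in>A. \<exists>\<psi>\<in>B. P (\<phi> \<^bold>\<and> \<psi>))"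
  by (auto simp: con_set_def)

lemma con_set_singleton: "con_set A {\<phi>} = {\<psi> \<^bold>\<and> \<phi> | \<psi>. \<psi> \<in> A}"
  by (auto simp: con_set_def)

lemma con_set_con_set:
  "con_set (con_set A B) C = {(\<phi> \<^bold>\<and> \<psi>) \<^bold>\<and> \<chi> | \<phi> \<psi> \<chi>. \<phi> \<in> A \<and> \<psi> \<in> B \<and> \<chi> \<in> C}"
  unfolding con_set_def by blast

context consequence_operation
begin

lemma Cn_singletonI: "(\<And>v. holds v \<phi> \<Longrightarrow> holds v \<psi>) \<Longrightarrow> \<psi> \<in> Cn {\<phi>}"
  by (rule supraclassicality) (auto simp: taut_conseq_def)

lemma closed_conseq:
  assumes "Cn X = X" "\<phi> \<in> X" "\<psi> \<in> Cn {\<phi>}"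
  shows "\<psi> \<in> X"
  using assms monotony[of "{\<phi>}" X] by auto

lemma closed_con_iff:
  assumes "Cn X = X"
  shows "\<phi> \<^bold>\<and> \<psi> \<in> X \<longleftrightarrow> \<phi> \<in> X \<and> \<psi> \<in> X"
proof
  show "\<phi> \<^bold>\<and> \<psi> \<in> X \<Longrightarrow> \<phi> \<in> X \<and> \<psi> \<in> X"
    using closed_conseq[OF assms] Cn_singletonI by (meson holds.simps(3))
  have "\<phi> \<^bold>\<and> \<psi> \<in> Cn X" if "\<phi> \<in> X" "\<psi> \<in> X"
    using that by (intro supraclassicality) (auto simp: taut_conseq_def)
  then show "\<phi> \<in> X \<and> \<psi> \<in> X \<Longrightarrow> \<phi> \<^bold>\<and> \<psi> \<in> X"
    using assms by simp
qed

text \<open>A closed set contains a conjunction exactly when it contains both conjuncts. This turns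
  questions about \<open>con_set\<close> into questions about its factors.\<close>

lemma con_set_meets_iff:
  assumes "Cn X = X"
  shows "con_set A B \<inter> X \<noteq> {} \<longleftrightarrow> A \<inter> X \<noteq> {} \<and> B \<inter> X \<noteq> {}"
proof -
  have "S \<inter> X \<noteq> {} \<longleftrightarrow> (\<exists>\<phi>\<in>S. \<phi> \<in> X)" for S by blast
  then show ?thesis by (simp add: closed_con_iff[OF assms])
qed

lemma ex_theorem: "\<exists>\<tau>. \<forall>X. \<tau> \<in> Cn X"
proof (intro exI allI)
  fix X
  show "(Atom undefined \<^bold>\<rightarrow> Atom undefined) \<in> Cn X"
    by (rule supraclassicality) (simp add: taut_conseq_def)
qed

end

section \<open>From a choice revision to a believability relation\<close>

locale choice_revision = consistent_belief_set Cn K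
  for Cn :: "'v fm set \<Rightarrow> 'v fm set" and K :: "'v fm set" +
  fixes cr :: "'v fm set \<Rightarrow> 'v fm set"
  assumes closure: "rev_closure Cn cr"
    and relative_success: "rev_relative_success K cr"
    and regularity: "rev_regularity cr"
    and confirmation: "rev_confirmation K cr"
    and reciprocity: "rev_reciprocity cr"
begin

text \<open>For finite \<open>B\<close>, regularity makes \<open>B \<inter> cr B = {}\<close> say
  that no outcome of a finite input meets \<open>B\<close>; such a \<open>B\<close> lies below
  everything. The other disjunct is revealed preference on the menu
  \<open>A \<union> B\<close>.\<close>

definition rel :: "'v fm set \<Rightarrow> 'v fm set \<Rightarrow> bool" where
  "rel A B \<longleftrightarrow> B \<inter> cr B = {} \<or> A \<inter> cr (A \<union> B) \<noteq> {}"

lemma cr_closed: "finite A \<Longrightarrow> Cn (cr A) = cr A"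
  using closure by (simp add: rev_closure_def)

lemma cr_regular: "finite A \<Longrightarrow> finite B \<Longrightarrow> A \<inter> cr B \<noteq> {} \<Longrightarrow> A \<inter> cr A \<noteq> {}"
  using regularity unfolding rev_regularity_def by blast

lemma cr_confirm: "finite A \<Longrightarrow> A \<inter> K \<noteq> {} \<Longrightarrow> cr A = K"
  using confirmation unfolding rev_confirmation_def by blast

text \<open>Shrinking a menu without losing the chosen outcome does not change the choice:
  regularity makes \<open>cr A\<close> meet \<open>A\<close>, hence \<open>B\<close>, and
  reciprocity applies.\<close>

lemma cr_subset_eq:
  assumes "finite B" "A \<subseteq> B" "A \<inter> cr B \<noteq> {}"
  shows "cr A = cr B"
proof -
  have "finite A" using assms finite_subset by blast
  with assms have "A \<inter> cr A \<noteq> {}" using cr_regular by blast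
  then show ?thesis
    using assms \<open>finite A\<close> reciprocity unfolding rev_reciprocity_def by blast
qed

lemma cr_mono_success:
  assumes "finite B" "A \<subseteq> B" "A \<inter> cr A \<noteq> {}"
  shows "B \<inter> cr B \<noteq> {}"
  using assms cr_regular[of B A] finite_subset by blast

lemma rel_trans:
  assumes fin: "finite A" "finite B" "finite C" and AB: "rel A B" and BC: "rel B C"
  shows "rel A C"
proof (cases "C \<inter> cr C = {}")
  case False
  let ?D = "A \<union> B \<union> C"
  have meets_B: "B \<inter> cr (B \<union> C) \<noteq> {}"
    using BC False by (auto simp: rel_def)
  then have "B \<inter> cr B \<noteq> {}"
    using fin cr_regular[of B "B \<union> C"] by blast
  then have meets_A: "A \<inter> cr (A \<union> B) \<noteq> {}"
    using AB by (auto simp: rel_def)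
  \<comment> \<open>The joint menu \<open>?D\<close> succeeds because \<open>C\<close> does. If its
    outcome meets \<open>C\<close>, it is also the outcome of \<open>B \<union> C\<close> and so
    meets \<open>B\<close>; the same argument leads from \<open>B\<close> to
    \<open>A\<close>.\<close>
  have "?D \<inter> cr ?D \<noteq> {}"
    using fin False by (intro cr_mono_success[of ?D C]) auto
  moreover have "B \<inter> cr ?D \<noteq> {}" if "C \<inter> cr ?D \<noteq> {}"
    using that meets_B fin cr_subset_eq[of ?D "B \<union> C"] by auto
  moreover have "A \<inter> cr ?D \<noteq> {}" if "B \<inter> cr ?D \<noteq> {}"
    using that meets_A fin cr_subset_eq[of ?D "A \<union> B"] by auto
  ultimately have "A \<inter> cr ?D \<noteq> {}" by blast
  then have "A \<inter> cr (A \<union> C) \<noteq> {}"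
    using fin cr_subset_eq[of ?D "A \<union> C"] by auto
  then show ?thesis by (simp add: rel_def)
qed (simp add: rel_def)

lemma rel_counter_dominance:
  assumes fin: "finite A" "finite B" and dom: "\<forall>\<phi>\<in>B. \<exists>\<psi>\<in>A. \<psi> \<in> Cn {\<phi>}"
  shows "rel A B"
proof (cases "B \<inter> cr B = {}")
  case False
  then have "(A \<union> B) \<inter> cr (A \<union> B) \<noteq> {}"
    using fin by (intro cr_mono_success[of "A \<union> B" B]) auto
  \<comment> \<open>An outcome is closed, so with an element of \<open>B\<close> it contains the
    consequence lying in \<open>A\<close>.\<close>
  moreover have "A \<inter> cr (A \<union> B) \<noteq> {}" if "B \<inter> cr (A \<union> B) \<noteq> {}"
    using that dom fin closed_conseq[OF cr_closed[of "A \<union> B"]] by blast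
  ultimately show ?thesis unfolding rel_def by blast
qed (simp add: rel_def)

lemma rel_taut:
  assumes "finite A" "finite B" "\<forall>\<phi>\<in>B. \<exists>\<psi>\<in>A. \<forall>v. holds v \<phi> \<longrightarrow> holds v \<psi>"
  shows "rel A B"
  using assms Cn_singletonI by (intro rel_counter_dominance) blast+

lemma rel_minimality:
  assumes "finite A"
  shows "(\<forall>B. finite B \<longrightarrow> rel A B) \<longleftrightarrow> A \<inter> K \<noteq> {}"
proof
  \<comment> \<open>A theorem \<open>\<tau>\<close> serves as test: confirmation forces the outcome
    of \<open>A \<union> {\<tau>}\<close> to be \<open>K\<close>.\<close>
  obtain \<tau> where "\<tau> \<in> K" using ex_theorem belief_set by blast
  assume "\<forall>B. finite B \<longrightarrow> rel A B"
  then have "rel A {\<tau>}" by simp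
  moreover have "cr {\<tau>} = K" "cr (A \<union> {\<tau>}) = K"
    using assms \<open>\<tau> \<in> K\<close> cr_confirm by simp_all
  ultimately show "A \<inter> K \<noteq> {}" using \<open>\<tau> \<in> K\<close> by (simp add: rel_def)
next
  assume "A \<inter> K \<noteq> {}"
  then show "\<forall>B. finite B \<longrightarrow> rel A B"
    using assms cr_confirm[of "A \<union> B" for B] by (auto simp: rel_def)
qed

text \<open>Every closed outcome meeting \<open>con_set A B\<close> meets \<open>A\<close>, so
  adding \<open>con_set A B\<close> to the menu \<open>A\<close> leaves the outcome
  \<open>cr A\<close>. With \<open>B\<close> a singleton this recovers the elements of
  \<open>cr A\<close> from \<open>rel\<close>.\<close>

lemma sym_part_con_set_iff:
  assumes fin: "finite A" "finite B" and succ: "A \<inter> cr A \<noteq> {}"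
  shows "sym_part rel A (con_set A B) \<longleftrightarrow> B \<inter> cr A \<noteq> {}"
proof -
  let ?U = "con_set A B \<union> A"
  have "rel A (con_set A B)"
    using fin by (intro rel_taut) auto
  then have "sym_part rel A (con_set A B) \<longleftrightarrow> con_set A B \<inter> cr ?U \<noteq> {}"
    using succ by (auto simp: sym_part_def rel_def)
  moreover have "A \<inter> cr ?U \<noteq> {}"
  proof -
    have "?U \<inter> cr ?U \<noteq> {}"
      using fin succ by (intro cr_mono_success[of ?U A]) auto
    moreover have "A \<inter> cr ?U \<noteq> {}" if "con_set A B \<inter> cr ?U \<noteq> {}"
      using that con_set_meets_iff[OF cr_closed[of ?U]] fin by simp
    ultimately show ?thesis by blast
  qed
  then have "cr A = cr ?U"
    using fin by (intro cr_subset_eq) auto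
  ultimately show ?thesis
    using con_set_meets_iff[OF cr_closed[OF fin(1)]] succ by simp
qed

lemma rel_weak_coupling:
  assumes fin: "finite A" "finite B" "finite C"
    and "sym_part rel A (con_set A B)" "sym_part rel A (con_set A C)"
  shows "sym_part rel A (con_set (con_set A B) C)"
proof (cases "A \<inter> cr A = {}")
  case True
  have "rel A (con_set (con_set A B) C)"
    using fin by (intro rel_taut) auto
  with True show ?thesis by (simp add: sym_part_def rel_def)
next
  case False
  then have "B \<inter> cr A \<noteq> {}" "C \<inter> cr A \<noteq> {}"
    using assms sym_part_con_set_iff by auto
  \<comment> \<open>Meeting \<open>B\<close> and meeting \<open>C\<close> combine because
    \<open>cr A\<close> is closed; reassociating the conjunctions preserves the level by counter
    dominance.\<close>
  then have "con_set B C \<inter> cr A \<noteq> {}"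
    using con_set_meets_iff[OF cr_closed[OF fin(1)]] by simp
  then have "sym_part rel A (con_set A (con_set B C))"
    using fin False by (simp add: sym_part_con_set_iff)
  moreover have "rel (con_set A (con_set B C)) (con_set (con_set A B) C)"
    using fin by (intro rel_taut) auto
  moreover have "rel (con_set (con_set A B) C) (con_set A (con_set B C))"
    using fin by (intro rel_taut) auto
  ultimately show ?thesis
    unfolding sym_part_def using fin rel_trans
    by (meson finite_con_set)
qed

lemma cr_eq_rel:
  assumes "finite A"
  shows "cr A = (if strict_part rel A {} then {\<phi>. sym_part rel A (con_set A {\<phi>})} else K)"
proof -
  \<comment> \<open>The empty set is met by no outcome, so \<open>rel A {}\<close> always holds and
    \<open>rel {} A\<close> reduces to failure of \<open>A\<close>.\<close>
  have "strict_part rel A {} \<longleftrightarrow> A \<inter> cr A \<noteq> {}"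
    by (simp add: strict_part_def rel_def)
  then show ?thesis
    using relative_success assms by (auto simp: sym_part_con_set_iff rev_relative_success_def)
qed

end

section \<open>From a believability relation to a choice revision\<close>

locale multi_believability = consistent_belief_set Cn K
  for Cn :: "'v fm set \<Rightarrow> 'v fm set" and K :: "'v fm set" +
  fixes R :: "'v fm set \<Rightarrow> 'v fm set \<Rightarrow> bool"
  assumes transitivity: "bel_transitivity R"
    and weak_coupling: "bel_weak_coupling R"
    and counter_dominance: "bel_counter_dominance Cn R"
    and minimality: "bel_minimality K R"
    and union: "bel_union R"
begin

definition revision :: "'v fm set \<Rightarrow> 'v fm set" where
  "revision A = (if strict_part R A {} then {\<phi>. sym_part R A (con_set A {\<phi>})} else K)"

lemma R_trans:
  "R A B \<Longrightarrow> R B C \<Longrightarrow> finite A \<Longrightarrow> finite B \<Longrightarrow> finite C \<Longrightarrow> R A C"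
  using transitivity unfolding bel_transitivity_def by blast

lemma R_dom: "\<lbrakk>finite A; finite B; \<And>\<phi>. \<phi> \<in> B \<Longrightarrow> \<exists>\<psi>\<in>A. \<psi> \<in> Cn {\<phi>}\<rbrakk> \<Longrightarrow> R A B"
  using counter_dominance unfolding bel_counter_dominance_def by blast

lemma R_taut:
  assumes "finite A" "finite B" "\<forall>\<phi>\<in>B. \<exists>\<psi>\<in>A. \<forall>v. holds v \<phi> \<longrightarrow> holds v \<psi>"
  shows "R A B"
  using assms Cn_singletonI by (intro R_dom) blast+

lemma R_con_set: "finite A \<Longrightarrow> finite B \<Longrightarrow> R A (con_set A B)"
  by (rule R_taut) auto

lemma R_min: "finite A \<Longrightarrow> A \<inter> K \<noteq> {} \<longleftrightarrow> (\<forall>B. finite B \<longrightarrow> R A B)"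
  using minimality unfolding bel_minimality_def by blast

text \<open>Counter dominance gives the direction from \<open>A\<close> to its conjunctions for
  free, so weak coupling is needed only for the converse one.\<close>

lemma R_weak_coupling:
  assumes "finite A" "finite B" "finite C" "R (con_set A B) A" "R (con_set A C) A"
  shows "R (con_set (con_set A B) C) A"
proof -
  have "sym_part R A (con_set A B)" "sym_part R A (con_set A C)"
    using assms R_con_set by (auto simp: sym_part_def)
  with weak_coupling assms(1-3) show ?thesis
    unfolding bel_weak_coupling_def con_set_con_set
    unfolding con_set_def[symmetric] sym_part_def by blast
qed

lemma strict_part_empty_iff: "finite A \<Longrightarrow> strict_part R A {} \<longleftrightarrow> \<not> R {} A"
  using R_dom[of A "{}"] by (simp add: strict_part_def)

lemma in_rev_iff:
  "finite A \<Longrightarrow> \<not> R {} A \<Longrightarrow> \<phi> \<in> revision A \<longleftrightarrow> R (con_set A {\<phi>}) A"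
  by (simp add: revision_def strict_part_empty_iff sym_part_def R_con_set)

lemma rev_eq_K: "finite A \<Longrightarrow> R {} A \<Longrightarrow> revision A = K"
  by (simp add: revision_def strict_part_empty_iff)

text \<open>Otherwise transitivity would place \<open>{}\<close> among the minimal sets, which must
  meet \<open>K\<close>.\<close>

lemma not_R_empty_meets: "finite A \<Longrightarrow> A \<inter> K \<noteq> {} \<Longrightarrow> \<not> R {} A"
proof
  assume A: "finite A" "A \<inter> K \<noteq> {}" "R {} A"
  then have "R A B" if "finite B" for B using that R_min by blast
  then have "\<forall>B. finite B \<longrightarrow> R {} B" using A R_trans by blast
  then show False using R_min[of "{}"] by simp
qed

text \<open>The only use of the union postulate: when an element is inserted, either it represents
  the enlarged set, or the old set does and passes on its own representative.\<close>

lemma ex_singleton_R: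
  assumes "finite A" "A \<noteq> {}"
  shows "\<exists>\<phi>\<in>A. R {\<phi>} A"
  using assms
proof (induction A rule: finite_ne_induct)
  case (singleton \<phi>)
  then show ?case by (auto intro!: R_taut)
next
  case (insert \<phi> A)
  then obtain \<psi> where \<psi>: "\<psi> \<in> A" "R {\<psi>} A" by blast
  have "R {\<phi>} ({\<phi>} \<union> A) \<or> R A ({\<phi>} \<union> A)"
    using union insert.hyps unfolding bel_union_def by blast
  moreover have "R {\<psi>} (insert \<phi> A)" if "R A (insert \<phi> A)"
    using R_trans[OF \<psi>(2) that] insert.hyps by simp
  ultimately show ?case using \<psi>(1) by auto
qed

lemma rev_closed:
  assumes A: "finite A"
  shows "Cn (revision A) = revision A"
proof (cases "R {} A")
  case True
  with A show ?thesis using rev_eq_K belief_set by simp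
next
  case False
  note in_rev = in_rev_iff[OF A False]
  \<comment> \<open>By compactness finite premise sets suffice. The induction discharges one premise
    at a time through the deduction property.\<close>
  have conseq: "\<psi> \<in> revision A" if "finite Y" "Y \<subseteq> revision A" "\<psi> \<in> Cn Y" for Y \<psi>
    using that
  proof (induction Y arbitrary: \<psi> rule: finite_induct)
    case empty
    have "R (con_set A {\<psi>}) A"
    proof (rule R_dom)
      fix \<phi> assume \<phi>: "\<phi> \<in> A"
      have "\<psi> \<in> Cn {\<phi>}" using empty monotony[of "{}" "{\<phi>}"] by auto
      then have "\<phi> \<^bold>\<and> \<psi> \<in> Cn {\<phi>}"
        using inclusion[of "{\<phi>}"] by (simp add: closed_con_iff iteration)
      with \<phi> show "\<exists>\<chi>\<in>con_set A {\<psi>}. \<chi> \<in> Cn {\<phi>}" by auto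
    qed (use A in auto)
    then show ?case by (simp add: in_rev)
  next
    case (insert \<chi> Y)
    then have "\<chi> \<^bold>\<rightarrow> \<psi> \<in> Cn Y" using deduction[of \<psi> Y \<chi>] by simp
    then have "\<chi> \<^bold>\<rightarrow> \<psi> \<in> revision A" using insert by simp
    then have "R (con_set (con_set A {\<chi>}) {\<chi> \<^bold>\<rightarrow> \<psi>}) A"
      using insert.prems(1) A by (intro R_weak_coupling) (auto simp: in_rev)
    moreover have "R (con_set A {\<psi>}) (con_set (con_set A {\<chi>}) {\<chi> \<^bold>\<rightarrow> \<psi>})"
      using A by (intro R_taut) auto
    ultimately have "R (con_set A {\<psi>}) A"
      using R_trans A by (meson finite_con_set finite.intros)
    then show ?case by (simp add: in_rev)
  qed
  have "Cn (revision A) \<subseteq> revision A"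
    using compactness conseq by blast
  then show ?thesis using inclusion by blast
qed

lemma rev_success:
  assumes A: "finite A" "\<not> R {} A"
  shows "A \<inter> revision A \<noteq> {}"
proof -
  have "A \<noteq> {}" using A R_taut[of "{}" "{}"] by auto
  then obtain \<phi> where \<phi>: "\<phi> \<in> A" "R {\<phi>} A" using A ex_singleton_R by blast
  have "R (con_set A {\<phi>}) {\<phi>}" using A \<phi> by (intro R_taut) auto
  then have "R (con_set A {\<phi>}) A" using \<phi> A R_trans by (meson finite_con_set finite.intros)
  with A \<phi> show ?thesis by (auto simp: in_rev_iff)
qed

lemma rev_meets_R:
  assumes "finite A" "finite B" "\<not> R {} A" "revision A \<inter> B \<noteq> {}"
  shows "R (con_set A B) A" "R B A"
proof -
  obtain \<phi> where \<phi>: "\<phi> \<in> B" "R (con_set A {\<phi>}) A"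
    using assms in_rev_iff by blast
  have "R (con_set A B) (con_set A {\<phi>})" using assms \<phi> by (intro R_taut) auto
  then show AB: "R (con_set A B) A" using \<phi> assms R_trans by (meson finite_con_set finite.intros)
  have "R B (con_set A B)" using assms by (intro R_taut) auto
  then show "R B A" using AB assms R_trans by (meson finite_con_set)
qed

lemma rev_regular:
  assumes "finite A" "finite B" "A \<inter> revision B \<noteq> {}"
  shows "A \<inter> revision A \<noteq> {}"
proof (rule rev_success)
  show "\<not> R {} A"
  \<comment> \<open>If \<open>R {} B\<close>, the revision by \<open>B\<close> is \<open>K\<close>,
    so \<open>A\<close> meets \<open>K\<close>. Otherwise \<open>R A B\<close>, and
    \<open>R {} A\<close> would carry over to \<open>B\<close>.\<close>
  proof (cases "R {} B")
    case True
    with assms show ?thesis using rev_eq_K not_R_empty_meets by simp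
  next
    case False
    then have "R A B" using assms rev_meets_R(2)[of B A] by (simp add: Int_commute)
    with False show ?thesis using R_trans assms by blast
  qed
qed fact

lemma rev_confirm:
  assumes A: "finite A" "A \<inter> K \<noteq> {}"
  shows "revision A = K"
proof -
  have "\<phi> \<in> revision A \<longleftrightarrow> \<phi> \<in> K" for \<phi>
  proof -
    have "\<phi> \<in> revision A \<longleftrightarrow> R (con_set A {\<phi>}) A"
      using A not_R_empty_meets in_rev_iff by simp
    \<comment> \<open>Since \<open>A\<close> meets \<open>K\<close>, it is minimal; being at least
      as believable as \<open>A\<close> is then the same as being minimal.\<close>
    also have "\<dots> \<longleftrightarrow> (\<forall>B. finite B \<longrightarrow> R (con_set A {\<phi>}) B)"
      using A R_min R_trans by (meson finite_con_set finite.intros)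
    also have "\<dots> \<longleftrightarrow> con_set A {\<phi>} \<inter> K \<noteq> {}"
      using A by (simp add: R_min)
    also have "\<dots> \<longleftrightarrow> \<phi> \<in> K"
      using A con_set_meets_iff[OF belief_set[symmetric]] by simp
    finally show ?thesis .
  qed
  then show ?thesis by blast
qed

text \<open>One half of reciprocity. Weak coupling adds \<open>\<chi>\<close> to the conjunctions of
  \<open>A\<close> and \<open>B\<close>; dropping the conjunct from \<open>A\<close> and using
  \<open>R A B\<close> moves \<open>\<chi>\<close> to the revision by \<open>B\<close>.\<close>

lemma rev_subset:
  assumes fin: "finite A" "finite B" and "\<not> R {} A" "\<not> R {} B"
    and "revision A \<inter> B \<noteq> {}" "revision B \<inter> A \<noteq> {}"
  shows "revision A \<subseteq> revision B"
proof
  fix \<chi> assume "\<chi> \<in> revision A"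
  then have "R (con_set (con_set A B) {\<chi>}) A"
    using assms by (intro R_weak_coupling rev_meets_R) (auto simp: in_rev_iff)
  moreover have "R (con_set B {\<chi>}) (con_set (con_set A B) {\<chi>})"
    using fin by (intro R_taut) auto
  moreover have "R A B" using assms rev_meets_R by blast
  ultimately have "R (con_set B {\<chi>}) B"
    using fin R_trans by (meson finite_con_set finite.intros)
  with assms show "\<chi> \<in> revision B" by (simp add: in_rev_iff)
qed

lemma rev_reciprocal:
  assumes "finite A" "finite B" "revision A \<inter> B \<noteq> {}" "revision B \<inter> A \<noteq> {}"
  shows "revision A = revision B"
proof (cases "R {} A \<or> R {} B")
  case True
  \<comment> \<open>A failing input returns \<open>K\<close>; the other input then meets
    \<open>K\<close>, so confirmation returns \<open>K\<close> there too.\<close>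
  then show ?thesis using assms rev_eq_K rev_confirm by (metis Int_commute)
next
  case False
  with assms show ?thesis using rev_subset by blast
qed

end

theorem theorem4:
  fixes Cn :: "'v fm set \<Rightarrow> 'v fm set"
    and K :: "'v fm set"
    and cr :: "'v fm set \<Rightarrow> 'v fm set"
  assumes "consistent_belief_set Cn K"
  shows "rev_closure Cn cr \<and> rev_relative_success K cr \<and> rev_regularity cr \<and>
         rev_confirmation K cr \<and> rev_reciprocity cr
    \<longleftrightarrow> (\<exists>R :: 'v fm set \<Rightarrow> 'v fm set \<Rightarrow> bool.
          bel_transitivity R \<and> bel_weak_coupling R \<and> bel_counter_dominance Cn R \<and>
          bel_minimality K R \<and> bel_union R \<and>
          (\<forall>A. finite A \<longrightarrow>
            cr A = (if strict_part R A {} then {\<phi>. sym_part R A {\<psi> \<^bold>\<and> \<phi> | \<psi>. \<psi> \<in> A}}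
                     else K)))"
    (is "?revision \<longleftrightarrow> (\<exists>R. ?relation R)")
proof
  assume ?revision
  with assms interpret choice_revision Cn K cr
    by (simp add: choice_revision_def choice_revision_axioms_def)
  have "bel_transitivity rel"
    using rel_trans unfolding bel_transitivity_def by blast
  moreover have "bel_weak_coupling rel"
    using rel_weak_coupling
    unfolding bel_weak_coupling_def con_set_con_set[symmetric] con_set_def[symmetric] by blast
  moreover have "bel_counter_dominance Cn rel"
    using rel_counter_dominance unfolding bel_counter_dominance_def by blast
  moreover have "bel_minimality K rel"
    using rel_minimality unfolding bel_minimality_def by blast
  \<comment> \<open>The menus \<open>A \<union> (A \<union> B)\<close> and
    \<open>B \<union> (A \<union> B)\<close> are both \<open>A \<union> B\<close>, whose outcome
    meets \<open>A\<close>, meets \<open>B\<close> or misses the whole menu.\<close>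
  moreover have "bel_union rel"
    unfolding bel_union_def rel_def by (simp add: Un_commute Un_left_commute) blast
  ultimately show "\<exists>R. ?relation R"
    using cr_eq_rel unfolding con_set_singleton by blast
next
  assume "\<exists>R. ?relation R"
  then obtain R where R: "?relation R" by blast
  with assms interpret multi_believability Cn K R
    by (simp add: multi_believability_def multi_believability_axioms_def)
  have cr: "cr A = revision A" if "finite A" for A
    using R that by (simp add: revision_def con_set_singleton)
  have "rev_closure Cn cr"
    by (simp add: rev_closure_def cr rev_closed)
  moreover have "rev_relative_success K cr"
    using rev_eq_K rev_success by (auto simp: rev_relative_success_def cr)
  moreover have "rev_regularity cr"
    using rev_regular by (simp add: rev_regularity_def cr)
  moreover have "rev_confirmation K cr"
    using rev_confirm by (simp add: rev_confirmation_def cr)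
  moreover have "rev_reciprocity cr"
    using rev_reciprocal by (simp add: rev_reciprocity_def cr)
  ultimately show ?revision by blast
qed

end
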